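(* Let $A\in\mathbb{C}^{n\times n}$, $B\in\mathbb{R}^{m\times n}$, $C\in\mathbb{R}^{m\times m}$ be the blocks of the discretized mixed formulation of the elastic Helmholtz equation described in the context, let $A_p = BB^T\operatorname{diag}(\mu)-\omega^2M_p\in\mathbb{C}^{m\times m}$ with $M_p=\operatorname{diag}\big(\rho(1-\tfrac{\gamma}{\omega}i)\big)$, and set $$\Xi = BA-A_pB\in\mathbb{C}^{m\times n},\qquad H_p = BB^T+A_pC\in\mathbb{C}^{m\times m}.$$ Assume $A$ and $H_p$ are invertible. Define the $(n+m)\times(n+m)$ matrices $$\mathcal{K}=\begin{pmatrix}A & B^T\\ \Xi & H_p\end{pmatrix},\qquad \mathcal{P}=\begin{pmatrix}A & B^T\\ 0 & H_p\end{pmatrix},\qquad T=I-\mathcal{P}^{-1}\mathcal{K}.$$ Then: 1. The preconditioned matrix $\mathcal{P}^{-1}\mathcal{K}$ has the eigenvalue $1$ with multiplicity at least $n$; namely, the error iteration matrix $T$ has a nullspace of dimension at least $n$. 2. Let $Z$ be the $m\times m$ matrix $$Z=\Xi A^{-1}B^TH_p^{-1}.$$ Then $\operatorname{spec}(T)=\operatorname{spec}(Z)\cup\{0\}$, and consequently the spectral radii agree: $\rho(T)=\rho(Z)$.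
   Context: Here $\operatorname{spec}(\cdot)$ is the set of eigenvalues in $\mathbb{C}$, and $\rho(\cdot)$ applied to a matrix is its spectral radius. $I$ is the identity matrix and $i$ the imaginary unit. $B^T$ is the (real) transpose of $B$. Setting. The elastic Helmholtz equation in mixed form, with displacement $\vec u$ and pressure $p=-(\lambda+\mu)\nabla\cdot\vec u$, is discretized by second-order finite differences on a marker-and-cell (MAC) staggered rectangular grid in dimension 2 or 3: the components of the displacement are located at the cell faces orthogonal to the corresponding coordinate direction ($n$ displacement unknowns in total), and the pressure is located at the cell centers ($m$ unknowns, one per cell). The physical parameters are vectors of cell-centered values: density $\rho\in\mathbb{R}^m$ with positive entries, Lamé coefficients $\lambda,\mu\in\mathbb{R}^m$ with positive entries, attenuation $\gamma\in\mathbb{R}^m$ with nonnegative entries; $\omega>0$ is the angular frequency. Operations on these vectors are entrywise, and $\operatorname{diag}(\cdot)$ is the diagonal matrix with the given diagonal. (Although the same letter $\rho$ denotes the density vector and the spectral radius, the spectral radius is always written with a matrix argument.) The discrete system matrix is $$\begin{pmatrix}A & B^T\\ B & -C\end{pmatrix},\qquad A=\vec\nabla_h^{T}A_e(\mu)\vec\nabla_h-\omega^2M,\quad B^T=\nabla_h,\quad C=\operatorname{diag}\Big(\frac{1}{\lambda+\mu}\Big),$$ where: - $\nabla_h\in\mathbb{R}^{n\times m}$ is the discrete gradient from cell centers to faces (differences of neighbouring cell values divided by the mesh width), so $B=\nabla_h^T\in\mathbb{R}^{m\times n}$ is the discrete negative divergence; - $\vec\nabla_h$ is the real matrix of the discrete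 vector gradient, acting on each face-centered displacement component separately by differences of neighbouring values divided by the mesh width (so $A$ is block diagonal with one block for each displacement component); - $A_e(\mu)$ is the real diagonal matrix of the values of $\mu$ averaged to the locations of the entries of $\vec\nabla_h\vec u$; - $M=A_f\big(\rho(1-\tfrac{\gamma}{\omega}i)\big)\in\mathbb{C}^{n\times n}$ is the diagonal mass matrix with the cell values of $\rho(1-\tfrac{\gamma}{\omega}i)$ averaged to the faces. The treatment of these stencils at the boundary of the domain may be any fixed choice. The matrix $\mathcal{K}$ equals $\begin{pmatrix}I&0\\ B&-A_p\end{pmatrix}\begin{pmatrix}A&B^T\\ B&-C\end{pmatrix}$. *)

theory Defs
  imports
    "Jordan_Normal_Form.Matrix"
    "Jordan_Normal_Form.Gauss_Jordan_Elimination"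
    "Jordan_Normal_Form.Matrix_Kernel"
    "Jordan_Normal_Form.Spectral_Radius"
begin

section \<open>MAC grid\<close>

text \<open>
  The grid has dimension \<open>d\<close>, \<open>N i\<close> cells and mesh width \<open>h i\<close> in direction \<open>i < d\<close>. Grid points are
  multi-indices of length \<open>d\<close>. In a coordinate where a point is cell-centred the index \<open>p ! i\<close> stands
  for the position \<open>(p ! i + 1/2) * h i\<close>; in a coordinate where it is nodal it stands for
  \<open>p ! i * h i\<close>. Hence the face \<open>(k, f)\<close>, orthogonal to direction \<open>k\<close>, separates the cells
  \<open>f[k := f ! k - 1]\<close> and \<open>f\<close>.
\<close>

type_synonym midx = "nat list"

definition mac_cells :: "nat \<Rightarrow> (nat \<Rightarrow> nat) \<Rightarrow> midx set" where
  "mac_cells d N = {c. length c = d \<and> (\<forall>i<d. c ! i < N i)}"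

definition mac_faces :: "nat \<Rightarrow> (nat \<Rightarrow> nat) \<Rightarrow> (nat \<times> midx) set" where
  "mac_faces d N = {(k, f). k < d \<and> length f = d \<and>
     (\<forall>i<d. if i = k then f ! i \<le> N i else f ! i < N i)}"

fun interior_face :: "(nat \<Rightarrow> nat) \<Rightarrow> nat \<times> midx \<Rightarrow> bool" where
  "interior_face N (k, f) \<longleftrightarrow> 0 < f ! k \<and> f ! k < N k"

text \<open>
  \<open>(k, j, e)\<close> is a location of the difference in direction \<open>j\<close> of the \<open>k\<close>-th displacement
  component. It is a cell centre if \<open>j = k\<close>; otherwise it is nodal in both directions \<open>k\<close> and \<open>j\<close>
  (a grid node for \<open>d = 2\<close>, the midpoint of a cell edge for \<open>d = 3\<close>).
\<close>

definition mac_grad_locs :: "nat \<Rightarrow> (nat \<Rightarrow> nat) \<Rightarrow> (nat \<times> nat \<times> midx) set" where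
  "mac_grad_locs d N = {(k, j, e). k < d \<and> j < d \<and> length e = d \<and>
     (\<forall>i<d. if j \<noteq> k \<and> (i = k \<or> i = j) then e ! i \<le> N i else e ! i < N i)}"

fun lower_face :: "nat \<times> nat \<times> midx \<Rightarrow> nat \<times> midx" where
  "lower_face (k, j, e) = (k, if j = k then e else e[j := e ! j - 1])"

fun upper_face :: "nat \<times> nat \<times> midx \<Rightarrow> nat \<times> midx" where
  "upper_face (k, j, e) = (k, if j = k then e[k := e ! k + 1] else e)"

fun interior_loc :: "(nat \<Rightarrow> nat) \<Rightarrow> nat \<times> nat \<times> midx \<Rightarrow> bool" where
  "interior_loc N (k, j, e) \<longleftrightarrow>
     interior_face N (lower_face (k, j, e)) \<and> interior_face N (upper_face (k, j, e)) \<and>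
     (j \<noteq> k \<longrightarrow> 0 < e ! j \<and> e ! j < N j)"

text \<open>
  \<open>cs\<close>, \<open>fs\<close>, \<open>ls\<close> number the pressure unknowns (cells), the displacement unknowns (faces) and the
  entries of the vector gradient; any numbering is allowed. Which of the faces on the boundary of the
  domain carry an unknown is part of the boundary treatment, hence left open.
\<close>

definition mac_grid ::
  "nat \<Rightarrow> (nat \<Rightarrow> nat) \<Rightarrow> (nat \<Rightarrow> real) \<Rightarrow> midx list \<Rightarrow> (nat \<times> midx) list \<Rightarrow>
   (nat \<times> nat \<times> midx) list \<Rightarrow> bool" where
  "mac_grid d N h cs fs ls \<longleftrightarrow>
     (\<forall>i<d. N i \<ge> 1 \<and> h i > 0) \<and>
     distinct cs \<and> set cs = mac_cells d N \<and>
     distinct fs \<and> {x \<in> mac_faces d N. interior_face N x} \<subseteq> set fs \<and> set fs \<subseteq> mac_faces d N \<and>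
     distinct ls \<and> set ls = mac_grad_locs d N"

section \<open>Stencils\<close>

text \<open>
  Each stencil is a real matrix whose rows are prescribed away from the boundary of the domain only;
  the rows at the boundary are unconstrained, so that every boundary treatment is covered (a zero row
  amounts to leaving out the location). What holds for all rows is that the vector gradient acts on
  each displacement component separately, and that averaging to a cell centre gives the cell value.
\<close>

definition difference_entry :: "real \<Rightarrow> 'a \<Rightarrow> 'a \<Rightarrow> 'a \<Rightarrow> real" where
  "difference_entry w lower upper x =
     (if x = upper then 1 / w else if x = lower then - 1 / w else 0)"

definition is_cell_gradient ::
  "(nat \<Rightarrow> nat) \<Rightarrow> (nat \<Rightarrow> real) \<Rightarrow> midx list \<Rightarrow> (nat \<times> midx) list \<Rightarrow> real mat \<Rightarrow> bool" where
  "is_cell_gradient N h cs fs G \<longleftrightarrow>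
     G \<in> carrier_mat (length fs) (length cs) \<and>
     (\<forall>r<length fs. \<forall>s<length cs. \<forall>k f. fs ! r = (k, f) \<longrightarrow> interior_face N (k, f) \<longrightarrow>
        G $$ (r, s) = difference_entry (h k) (f[k := f ! k - 1]) f (cs ! s))"

definition is_vector_gradient ::
  "(nat \<Rightarrow> nat) \<Rightarrow> (nat \<Rightarrow> real) \<Rightarrow> (nat \<times> midx) list \<Rightarrow> (nat \<times> nat \<times> midx) list \<Rightarrow> real mat \<Rightarrow> bool"
  where
  "is_vector_gradient N h fs ls V \<longleftrightarrow>
     V \<in> carrier_mat (length ls) (length fs) \<and>
     (\<forall>r<length ls. \<forall>s<length fs. \<forall>k j e. ls ! r = (k, j, e) \<longrightarrow>
        (fst (fs ! s) \<noteq> k \<longrightarrow> V $$ (r, s) = 0) \<and>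
        (interior_loc N (k, j, e) \<longrightarrow>
           V $$ (r, s) =
             difference_entry (h j) (lower_face (k, j, e)) (upper_face (k, j, e)) (fs ! s)))"

text \<open>The matrices of \<open>A_f\<close> and \<open>A_e\<close> (arithmetic means of the adjacent cell values).\<close>

definition is_face_average ::
  "(nat \<Rightarrow> nat) \<Rightarrow> midx list \<Rightarrow> (nat \<times> midx) list \<Rightarrow> real mat \<Rightarrow> bool" where
  "is_face_average N cs fs W \<longleftrightarrow>
     W \<in> carrier_mat (length fs) (length cs) \<and>
     (\<forall>r<length fs. \<forall>s<length cs. \<forall>k f. fs ! r = (k, f) \<longrightarrow> interior_face N (k, f) \<longrightarrow>
        W $$ (r, s) = (if cs ! s \<in> {f[k := f ! k - 1], f} then 1 / 2 else 0))"

definition is_edge_average ::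
  "(nat \<Rightarrow> nat) \<Rightarrow> midx list \<Rightarrow> (nat \<times> nat \<times> midx) list \<Rightarrow> real mat \<Rightarrow> bool" where
  "is_edge_average N cs ls W \<longleftrightarrow>
     W \<in> carrier_mat (length ls) (length cs) \<and>
     (\<forall>r<length ls. \<forall>s<length cs. \<forall>k j e. ls ! r = (k, j, e) \<longrightarrow>
        (j = k \<longrightarrow> W $$ (r, s) = (if cs ! s = e then 1 else 0)) \<and>
        (j \<noteq> k \<longrightarrow> interior_loc N (k, j, e) \<longrightarrow>
           W $$ (r, s) =
             (if cs ! s \<in> {e, e[k := e ! k - 1], e[j := e ! j - 1],
                           e[k := e ! k - 1, j := e ! j - 1]}
              then 1 / 4 else 0)))"

section \<open>Matrices of the discrete system\<close>

abbreviation cmat :: "real mat \<Rightarrow> complex mat" where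
  "cmat \<equiv> map_mat complex_of_real"

definition diag_of :: "'a :: zero vec \<Rightarrow> 'a mat" where
  "diag_of v = mat_diag (dim_vec v) (\<lambda>i. v $ i)"

text \<open>The entrywise vector \<open>\<rho> (1 - \<gamma> / \<omega> \<i>)\<close>.\<close>

definition complex_density :: "real \<Rightarrow> real vec \<Rightarrow> real vec \<Rightarrow> complex vec" where
  "complex_density \<omega> \<rho> \<gamma> =
     vec (dim_vec \<rho>) (\<lambda>i. complex_of_real (\<rho> $ i) * (1 - complex_of_real (\<gamma> $ i / \<omega>) * \<i>))"

definition face_mass :: "real mat \<Rightarrow> real \<Rightarrow> real vec \<Rightarrow> real vec \<Rightarrow> complex mat" where
  "face_mass Wf \<omega> \<rho> \<gamma> = diag_of (cmat Wf *\<^sub>v complex_density \<omega> \<rho> \<gamma>)"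

definition displacement_block ::
  "real mat \<Rightarrow> real mat \<Rightarrow> real mat \<Rightarrow> real \<Rightarrow> real vec \<Rightarrow> real vec \<Rightarrow> real vec \<Rightarrow> complex mat" where
  "displacement_block V We Wf \<omega> \<rho> \<mu> \<gamma> =
     cmat (transpose_mat V * diag_of (We *\<^sub>v \<mu>) * V)
       - complex_of_real (\<omega>\<^sup>2) \<cdot>\<^sub>m face_mass Wf \<omega> \<rho> \<gamma>"

definition compliance_block :: "real vec \<Rightarrow> real vec \<Rightarrow> real mat" where
  "compliance_block \<Lambda> \<mu> = diag_of (vec (dim_vec \<mu>) (\<lambda>i. 1 / (\<Lambda> $ i + \<mu> $ i)))"

definition pressure_operator ::
  "real mat \<Rightarrow> real \<Rightarrow> real vec \<Rightarrow> real vec \<Rightarrow> real vec \<Rightarrow> complex mat" where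
  "pressure_operator B \<omega> \<rho> \<mu> \<gamma> =
     cmat (B * transpose_mat B * diag_of \<mu>)
       - complex_of_real (\<omega>\<^sup>2) \<cdot>\<^sub>m diag_of (complex_density \<omega> \<rho> \<gamma>)"

text \<open>Meaningful for invertible square matrices only.\<close>

definition inv_mat :: "'a :: field mat \<Rightarrow> 'a mat" where
  "inv_mat X = the (mat_inverse X)"

end

theory Submission
  imports Defs
begin

text \<open>
  With \<open>E = A\<inverse> B\<^sup>T\<close> and \<open>F = H\<^sub>p\<inverse> \<Xi>\<close>, the matrices \<open>\<K>\<close> and \<open>\<P>\<close> differ in the block \<open>\<Xi>\<close> only,
  so \<open>T\<close> has the block rows \<open>(E F, 0)\<close> and \<open>(- F, 0)\<close>. Adding \<open>E\<close> times the second block row to the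
  first one, and undoing this on the columns, is a similarity that turns \<open>T\<close> into the matrix with
  block rows \<open>(0, 0)\<close> and \<open>(- F, F E)\<close>. Hence \<open>T\<close> has rank at most \<open>m\<close> and characteristic polynomial
  \<open>x\<^sup>n\<close> times that of \<open>F E\<close>, and \<open>F E = H\<^sub>p\<inverse> Z H\<^sub>p\<close>. If \<open>n = 0\<close>, then \<open>0\<close> is still an eigenvalue of \<open>T\<close>,
  because the grid has a cell and the last \<open>m\<close> columns of \<open>T\<close> vanish.
\<close>

section \<open>Inverses as given by \<open>inv_mat\<close>\<close>

text \<open>\<open>X\<close> is a unit of the matrix ring, so \<open>mat_inverse\<close> cannot
  return \<open>None\<close>; what it returns is \<open>Y\<close> because inverses are
  unique.\<close>

lemma inv_mat_eqI:
  fixes X Y :: "'a :: field mat"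
  assumes X: "X \<in> carrier_mat k k" and Y: "Y \<in> carrier_mat k k"
    and XY: "X * Y = 1\<^sub>m k" and YX: "Y * X = 1\<^sub>m k"
  shows "inv_mat X = Y"
proof -
  have "X \<in> Units (ring_mat TYPE('a) k ())"
    using X Y XY YX unfolding Units_def ring_mat_def by auto
  then obtain Y' where Y': "mat_inverse X = Some Y'"
    using mat_inverse(1)[OF X, of "()"] by (cases "mat_inverse X") auto
  from mat_inverse(2)[OF X Y'] have *: "Y' * X = 1\<^sub>m k" "Y' \<in> carrier_mat k k" by auto
  have "Y' = Y' * (X * Y)" using XY * by simp
  also have "\<dots> = Y" unfolding assoc_mult_mat[OF *(2) X Y, symmetric] * using Y by simp
  finally show ?thesis unfolding inv_mat_def Y' by simp
qed

lemma inv_mat_invertible: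
  fixes X :: "'a :: field mat"
  assumes X: "X \<in> carrier_mat k k" and inv: "invertible_mat X"
  shows "inv_mat X \<in> carrier_mat k k" "X * inv_mat X = 1\<^sub>m k" "inv_mat X * X = 1\<^sub>m k"
proof -
  from inv obtain Y where XY: "X * Y = 1\<^sub>m k" and YX: "Y * X = 1\<^sub>m (dim_row Y)"
    unfolding invertible_mat_def inverts_mat_def using X by auto
  \<comment> \<open>Invertibility leaves the shape of \<open>Y\<close> open; comparing column counts
    in the two equations makes it square of size \<open>k\<close>.\<close>
  from arg_cong[OF XY, of dim_col] arg_cong[OF YX, of dim_col]
  have Y: "Y \<in> carrier_mat k k" using X by auto
  then have "inv_mat X = Y" using inv_mat_eqI[OF X Y XY] YX by simp
  then show "inv_mat X \<in> carrier_mat k k" "X * inv_mat X = 1\<^sub>m k" "inv_mat X * X = 1\<^sub>m k"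
    using Y XY YX by auto
qed

section \<open>Lower bounds for the kernel dimension\<close>

text \<open>Rank-nullity read off from the Gauss-Jordan form: the kernel dimension is the number of
  columns without a pivot, and there is one pivot for each nonzero row.\<close>

lemma kernel_dim_ge_cols_minus_rows:
  fixes M :: "'a :: field mat"
  assumes M: "M \<in> carrier_mat nr nc"
  shows "nc - nr \<le> kernel_dim M"
proof -
  let ?R = "gauss_jordan_single M"
  have R: "?R \<in> carrier_mat nr nc" and "row_echelon_form ?R"
    using gauss_jordan_single[OF M refl] by auto
  then have "length (pivot_positions ?R) = card {i. i < nr \<and> row ?R i \<noteq> 0\<^sub>v nc}"
    using find_base_vectors(5) by blast
  also have "\<dots> \<le> card {..<nr}" by (rule card_mono) auto
  finally show ?thesis unfolding kernel_dim_code using M by auto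
qed

text \<open>Zero rows impose no condition on a kernel vector, so the kernel is that of the block
  \<open>L\<close> of the last \<open>nr\<close> rows, to which the previous bound applies.\<close>

lemma kernel_dim_ge_zero_rows:
  fixes M :: "'a :: field mat"
  assumes M: "M \<in> carrier_mat (k + nr) nc"
    and zero: "\<And>i. i < k \<Longrightarrow> row M i = 0\<^sub>v nc"
  shows "nc - nr \<le> kernel_dim M"
proof -
  define L where "L = mat nr nc (\<lambda>(i, j). M $$ (k + i, j))"
  have L: "L \<in> carrier_mat nr nc" unfolding L_def by simp
  have row_L: "row L i = row M (k + i)" if "i < nr" for i
    using that M unfolding L_def by (intro eq_vecI) auto
  have "(M *\<^sub>v v = 0\<^sub>v (k + nr)) = (L *\<^sub>v v = 0\<^sub>v nr)" if v: "v \<in> carrier_vec nc" for v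
  proof
    assume Mv: "M *\<^sub>v v = 0\<^sub>v (k + nr)"
    show "L *\<^sub>v v = 0\<^sub>v nr"
    proof (rule eq_vecI)
      fix i assume i: "i < dim_vec (0\<^sub>v nr :: 'a vec)"
      then have "(L *\<^sub>v v) $ i = (M *\<^sub>v v) $ (k + i)" using L M row_L by simp
      then show "(L *\<^sub>v v) $ i = 0\<^sub>v nr $ i" using i unfolding Mv by simp
    qed (use L in simp)
  next
    assume Lv: "L *\<^sub>v v = 0\<^sub>v nr"
    show "M *\<^sub>v v = 0\<^sub>v (k + nr)"
    proof (rule eq_vecI)
      fix i assume i: "i < dim_vec (0\<^sub>v (k + nr) :: 'a vec)"
      show "(M *\<^sub>v v) $ i = 0\<^sub>v (k + nr) $ i"
      proof (cases "i < k")
        case True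
        then show ?thesis using zero[OF True] i M v by simp
      next
        case False
        then have "(M *\<^sub>v v) $ i = (L *\<^sub>v v) $ (i - k)" using i L M row_L[of "i - k"] by simp
        then show ?thesis using i False unfolding Lv by simp
      qed
    qed (use M in simp)
  qed
  then have "mat_kernel M = mat_kernel L" unfolding mat_kernel[OF M] mat_kernel[OF L] by auto
  then have "kernel_dim M = kernel_dim L" unfolding kernel_dim_def using L M by simp
  then show ?thesis using kernel_dim_ge_cols_minus_rows[OF L] by simp
qed

section \<open>Similarity and characteristic polynomials\<close>

text \<open>Conjugation fixes the identity, so the given witnesses serve again.\<close>

lemma similar_mat_one_minus:
  fixes X Y :: "'a :: comm_ring_1 mat"
  assumes "similar_mat_wit X Y U V" and X: "X \<in> carrier_mat k k"
  shows "similar_mat (1\<^sub>m k - X) (1\<^sub>m k - Y)"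
proof -
  from similar_mat_witD2[OF X assms(1)]
  have UV: "U * V = 1\<^sub>m k" "V * U = 1\<^sub>m k" and X_eq: "X = U * Y * V"
    and Y: "Y \<in> carrier_mat k k" and U: "U \<in> carrier_mat k k" and V: "V \<in> carrier_mat k k"
    by auto
  have "U * (1\<^sub>m k - Y) * V = (U - U * Y) * V"
    using U Y by (simp add: mult_minus_distrib_mat[OF U one_carrier_mat Y])
  also have "\<dots> = U * V - U * Y * V"
    using U Y V by (intro minus_mult_distrib_mat) auto
  finally have "1\<^sub>m k - X = U * (1\<^sub>m k - Y) * V" using UV X_eq by simp
  then show ?thesis using UV U V X Y by (intro similar_matI[of _ _ U V k]) auto
qed

text \<open>Over the complex numbers the characteristic polynomials of both diagonal blocks split
  into linear factors, which is what \<open>char_poly_0_block'\<close> asks for.\<close>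

lemma char_poly_lower_block_triangular:
  fixes X Y Q :: "complex mat"
  assumes X: "X \<in> carrier_mat k k" and Q: "Q \<in> carrier_mat l k" and Y: "Y \<in> carrier_mat l l"
  shows "char_poly (four_block_mat X (0\<^sub>m k l) Q Y) = char_poly X * char_poly Y"
  using char_poly_factorized[OF X] char_poly_factorized[OF Y]
  by (intro char_poly_0_block'[OF refl _ _ X Q Y]) auto

lemma char_poly_zero_mat: "char_poly (0\<^sub>m k k :: 'a :: comm_ring_1 mat) = [:0, 1:] ^ k"
proof -
  have "char_poly (0\<^sub>m k k :: 'a mat) = (\<Prod>a\<leftarrow>diag_mat (0\<^sub>m k k). [:- a, 1:])"
    by (rule char_poly_upper_triangular[of _ k]) auto
  also have "diag_mat (0\<^sub>m k k :: 'a mat) = replicate k 0"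
    by (rule nth_equalityI) (auto simp: diag_mat_def)
  finally show ?thesis by simp
qed

lemma char_poly_one_mat: "char_poly (1\<^sub>m k :: 'a :: comm_ring_1 mat) = [:- 1, 1:] ^ k"
proof -
  have "char_poly (1\<^sub>m k :: 'a mat) = (\<Prod>a\<leftarrow>diag_mat (1\<^sub>m k). [:- a, 1:])"
    by (rule char_poly_upper_triangular[of _ k]) auto
  also have "diag_mat (1\<^sub>m k :: 'a mat) = replicate k 1"
    by (rule nth_equalityI) (auto simp: diag_mat_def)
  finally show ?thesis by simp
qed

section \<open>The error iteration matrix in block form\<close>

context
  fixes E F :: "'a :: comm_ring_1 mat" and n m :: nat
  assumes E: "E \<in> carrier_mat n m" and F: "F \<in> carrier_mat m n"
begin

text \<open>The first block row of \<open>?T\<close> is \<open>- E\<close> times the second, so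
  \<open>?V * ?T\<close> has a zero first block row; \<open>?U\<close> on the right then creates
  \<open>F * E\<close>. The witnesses stay explicit because the kernel dimension is transported
  along them.\<close>

lemma similar_error_iteration:
  "similar_mat_wit (four_block_mat (E * F) (0\<^sub>m n m) (- F) (0\<^sub>m m m))
     (four_block_mat (0\<^sub>m n n) (0\<^sub>m n m) (- F) (F * E))
     (four_block_mat (1\<^sub>m n) (- E) (0\<^sub>m m n) (1\<^sub>m m))
     (four_block_mat (1\<^sub>m n) E (0\<^sub>m m n) (1\<^sub>m m))"
    (is "similar_mat_wit ?T ?D ?U ?V")
proof (rule similar_mat_witI)
  have mE: "- E \<in> carrier_mat n m" and mF: "- F \<in> carrier_mat m n"
    and EF: "E * F \<in> carrier_mat n n" and FE: "F * E \<in> carrier_mat m m"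
    using E F by auto
  have "?U * ?V = four_block_mat (1\<^sub>m n) (E + - E) (0\<^sub>m m n) (1\<^sub>m m)"
    using E mE by (subst mult_four_block_mat[of _ n n _ m _ m _ _ n _ m]) auto
  also have "E + - E = 0\<^sub>m n m" using E by (intro eq_matI) auto
  finally show "?U * ?V = 1\<^sub>m (n + m)" by simp
  have "- 0\<^sub>m m m = (0\<^sub>m m m :: 'a mat)" by (rule eq_matI) auto
  then have "?V * ?U = four_block_mat (1\<^sub>m n) (- E + E) (0\<^sub>m m n) (1\<^sub>m m)"
    using E mE by (subst mult_four_block_mat[of _ n n _ m _ m _ _ n _ m]) auto
  also have "- E + E = 0\<^sub>m n m" using E by (intro eq_matI) auto
  finally show "?V * ?U = 1\<^sub>m (n + m)" by simp
  have "?U * ?D = four_block_mat (E * F) (- (E * (F * E))) (- F) (F * E)"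
    using E F mE mF FE by (subst mult_four_block_mat[of _ n n _ m _ m _ _ n _ m]) auto
  also have "\<dots> * ?V = four_block_mat (E * F) (E * F * E + - (E * (F * E))) (- F) (- (F * E) + F * E)"
    using E F mF EF FE by (subst mult_four_block_mat[of _ n n _ m _ m _ _ n _ m]) auto
  also have "E * F * E + - (E * (F * E)) = 0\<^sub>m n m"
    using E F by (subst assoc_mult_mat[OF E F E]) (intro eq_matI, auto)
  also have "- (F * E) + F * E = 0\<^sub>m m m" using FE by (intro eq_matI) auto
  finally show "?T = ?U * ?D * ?V" by simp
qed (use E F in auto)

text \<open>Serves the multiplicity of the eigenvalue 1: the zero block of size \<open>n\<close> in
  the similar matrix becomes an identity block.\<close>

lemma similar_one_minus_error_iteration:
  "similar_mat (1\<^sub>m (n + m) - four_block_mat (E * F) (0\<^sub>m n m) (- F) (0\<^sub>m m m))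
     (four_block_mat (1\<^sub>m n) (0\<^sub>m n m) F (1\<^sub>m m - F * E))"
proof -
  have "1\<^sub>m (n + m) - four_block_mat (0\<^sub>m n n) (0\<^sub>m n m) (- F) (F * E)
      = four_block_mat (1\<^sub>m n) (0\<^sub>m n m) F (1\<^sub>m m - F * E)"
    by (rule eq_matI) (use E F in auto)
  then show ?thesis
    using similar_mat_one_minus[OF similar_error_iteration, of "n + m"] E F by simp
qed

end

text \<open>The zero columns of \<open>?T\<close> account for \<open>m\<close> kernel dimensions
  only; the bound \<open>n\<close> becomes visible in the similar matrix \<open>?D\<close>, whose
  first \<open>n\<close> rows vanish.\<close>

lemma kernel_dim_error_iteration:
  fixes E F :: "'a :: field mat"
  assumes E: "E \<in> carrier_mat n m" and F: "F \<in> carrier_mat m n"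
  shows "n \<le> kernel_dim (four_block_mat (E * F) (0\<^sub>m n m) (- F) (0\<^sub>m m m))"
    (is "_ \<le> kernel_dim ?T")
proof -
  let ?D = "four_block_mat (0\<^sub>m n n) (0\<^sub>m n m) (- F) (F * E)"
  have T: "?T \<in> carrier_mat (n + m) (n + m)" and D: "?D \<in> carrier_mat (n + m) (n + m)"
    using E F by auto
  have "kernel_dim ?T = kernel_dim ?D"
    using similar_mat_wit_kernel_dim[OF T similar_error_iteration[OF E F]]
    unfolding kernel_dim_def carrier_matD(2)[OF T] carrier_matD(2)[OF D] .
  moreover have "row ?D i = 0\<^sub>v (n + m)" if "i < n" for i
    by (rule eq_vecI) (use that E F in auto)
  ultimately show ?thesis using kernel_dim_ge_zero_rows[OF D] by simp
qed

context
  fixes E F :: "complex mat" and n m :: nat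
  assumes E: "E \<in> carrier_mat n m" and F: "F \<in> carrier_mat m n"
begin

lemma spectrum_error_iteration:
  assumes m: "m > 0"
  shows "spectrum (four_block_mat (E * F) (0\<^sub>m n m) (- F) (0\<^sub>m m m)) = spectrum (F * E) \<union> {0}"
    (is "spectrum ?T = _")
proof -
  have T: "?T \<in> carrier_mat (n + m) (n + m)" and FE: "F * E \<in> carrier_mat m m" using E F by auto
  have "similar_mat ?T (four_block_mat (0\<^sub>m n n) (0\<^sub>m n m) (- F) (F * E))"
    unfolding similar_mat_def using similar_error_iteration[OF E F] by blast
  then have "char_poly ?T = char_poly (0\<^sub>m n n) * char_poly (F * E)"
    using E F by (simp add: char_poly_similar char_poly_lower_block_triangular[of _ n _ m])
  \<comment> \<open>The factor x^n contributes the root 0 only when \<open>n > 0\<close>, hence the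
    union with \<open>{0}\<close> on both sides.\<close>
  then have "spectrum ?T \<union> {0} = spectrum (F * E) \<union> {0}"
    unfolding spectrum_root_char_poly[OF T] spectrum_root_char_poly[OF FE]
    by (auto simp: char_poly_zero_mat)
  \<comment> \<open>To cover \<open>n = 0\<close>, a second factorization is used: \<open>?T\<close>
    is itself block triangular with a zero last block, which gives the factor x^m with
    \<open>m > 0\<close>.\<close>
  moreover have "0 \<in> spectrum ?T"
    unfolding spectrum_root_char_poly[OF T] using E F m
    by (subst char_poly_lower_block_triangular) (auto simp: char_poly_zero_mat)
  ultimately show ?thesis by (simp add: insert_absorb)
qed

text \<open>Algebraic multiplicity is measured as the order of a root; the identity block of the
  similar matrix contributes (x - 1)^n.\<close>

lemma order_one_minus_error_iteration:
  "n \<le> Polynomial.order 1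
     (char_poly (1\<^sub>m (n + m) - four_block_mat (E * F) (0\<^sub>m n m) (- F) (0\<^sub>m m m)))"
    (is "_ \<le> Polynomial.order 1 (char_poly ?X)")
proof -
  have X: "?X \<in> carrier_mat (n + m) (n + m)" using E F by auto
  have "char_poly ?X = char_poly (1\<^sub>m n) * char_poly (1\<^sub>m m - F * E)"
    using E F by (subst char_poly_similar[OF similar_one_minus_error_iteration[OF E F]],
        subst char_poly_lower_block_triangular) auto
  then have "[:- 1, 1:] ^ n dvd char_poly ?X" by (simp add: char_poly_one_mat)
  \<comment> \<open>Divisibility bounds the order of a nonzero polynomial only; this one is
    monic.\<close>
  moreover have "char_poly ?X \<noteq> 0" using degree_monic_char_poly[OF X] by auto
  ultimately show ?thesis by (simp add: order_max)
qed

end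

section \<open>Spectral radius and the shift by the identity\<close>

text \<open>Norms are nonnegative, so adjoining 0 leaves their maximum alone; \<open>k > 0\<close>
  makes the spectrum of \<open>X\<close> nonempty, so that \<open>Max\<close> is meaningful.\<close>

lemma spectral_radius_insert_zero:
  fixes X Y :: "complex mat"
  assumes X: "X \<in> carrier_mat k k" "k > 0" and spec: "spectrum Y = spectrum X \<union> {0}"
  shows "spectral_radius Y = spectral_radius X"
proof -
  have fin: "finite (spectrum X)" and ne: "spectrum X \<noteq> {}"
    using card_finite_spectrum(1) spectrum_non_empty X by auto
  then obtain c where "c \<in> spectrum X" by auto
  then have "norm c \<le> Max (norm ` spectrum X)" using fin by (intro Max_ge) auto
  then have "0 \<le> Max (norm ` spectrum X)" using norm_ge_zero[of c] by linarith
  moreover have "Max (norm ` spectrum Y) = max 0 (Max (norm ` spectrum X))"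
    unfolding spec using fin ne by simp
  ultimately show ?thesis unfolding spectral_radius_def by simp
qed

lemma eigenvalue_one_minus:
  fixes X :: "'a :: comm_ring_1 mat"
  assumes X: "X \<in> carrier_mat k k" and ev: "eigenvalue (1\<^sub>m k - X) c"
  shows "eigenvalue X (1 - c)"
proof -
  from ev obtain v where v: "v \<in> carrier_vec k" "v \<noteq> 0\<^sub>v k" "(1\<^sub>m k - X) *\<^sub>v v = c \<cdot>\<^sub>v v"
    unfolding eigenvalue_def eigenvector_def using X by auto
  have *: "v - X *\<^sub>v v = c \<cdot>\<^sub>v v"
    using v X minus_mult_distrib_mat_vec[OF one_carrier_mat X v(1)] by simp
  have "X *\<^sub>v v = (1 - c) \<cdot>\<^sub>v v"
  proof (rule eq_vecI)
    fix i assume i: "i < dim_vec ((1 - c) \<cdot>\<^sub>v v)"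
    have "(v - X *\<^sub>v v) $ i = (c \<cdot>\<^sub>v v) $ i" unfolding * ..
    then show "(X *\<^sub>v v) $ i = ((1 - c) \<cdot>\<^sub>v v) $ i"
      using i v(1) X by (simp add: algebra_simps)
  qed (use v X in auto)
  then show ?thesis unfolding eigenvalue_def eigenvector_def using v X by auto
qed

section \<open>Block triangular preconditioning\<close>

text \<open>Back substitution: the diagonal blocks of \<open>S\<close> invert those of
  \<open>P\<close>, and the remaining block \<open>R\<close> solves
  \<open>A * R + G * inv_mat H = 0\<close>. Both products are computed because
  \<open>inv_mat_eqI\<close> asks for a two-sided inverse.\<close>

lemma block_triangular_inverse:
  fixes A H :: "'a :: field mat"
  assumes A: "A \<in> carrier_mat n n" "invertible_mat A" and H: "H \<in> carrier_mat m m" "invertible_mat H"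
    and G: "G \<in> carrier_mat n m"
  defines "P \<equiv> four_block_mat A G (0\<^sub>m m n) H"
    and "S \<equiv> four_block_mat (inv_mat A) (- (inv_mat A * G * inv_mat H)) (0\<^sub>m m n) (inv_mat H)"
  shows "P * S = 1\<^sub>m (n + m)" "S * P = 1\<^sub>m (n + m)"
proof -
  note Ai = inv_mat_invertible[OF A] and Hi = inv_mat_invertible[OF H]
  define Q where "Q = inv_mat A * G * inv_mat H"
  define R where "R = - Q"
  have AiG: "inv_mat A * G \<in> carrier_mat n m" and GHi: "G * inv_mat H \<in> carrier_mat n m"
    using Ai Hi G by auto
  have Q: "Q \<in> carrier_mat n m" and R: "R \<in> carrier_mat n m"
    unfolding R_def Q_def using AiG Hi by auto
  have "A * Q = A * (inv_mat A * (G * inv_mat H))"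
    unfolding Q_def using assoc_mult_mat[OF Ai(1) G Hi(1)] by simp
  also have "\<dots> = A * inv_mat A * (G * inv_mat H)"
    by (rule assoc_mult_mat[OF A(1) Ai(1) GHi, symmetric])
  finally have "A * Q = G * inv_mat H" using Ai(2) left_mult_one_mat[OF GHi] by simp
  then have "A * R = - (G * inv_mat H)"
    unfolding R_def using uminus_mult_right_mat[of A Q] A Q by simp
  then have AR: "A * R + G * inv_mat H = 0\<^sub>m n m" using uminus_l_inv_mat[OF GHi] by simp
  have "P * S = four_block_mat (A * inv_mat A + G * 0\<^sub>m m n) (A * R + G * inv_mat H)
      (0\<^sub>m m n * inv_mat A + H * 0\<^sub>m m n) (0\<^sub>m m n * R + H * inv_mat H)"
    unfolding P_def S_def Q_def[symmetric] R_def[symmetric]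
    by (rule mult_four_block_mat[OF A(1) G zero_carrier_mat H(1) Ai(1) R zero_carrier_mat Hi(1)])
  then show "P * S = 1\<^sub>m (n + m)" using AR A(1) H(1) G Ai Hi R by simp
  have "Q * H = inv_mat A * G * (inv_mat H * H)"
    unfolding Q_def by (rule assoc_mult_mat[OF AiG Hi(1) H(1)])
  then have "Q * H = inv_mat A * G" using Hi(3) right_mult_one_mat[OF AiG] by simp
  then have "R * H = - (inv_mat A * G)"
    unfolding R_def using uminus_mult_left_mat[of Q H] H Q by simp
  then have RH: "inv_mat A * G + R * H = 0\<^sub>m n m"
    using comm_add_mat[OF AiG, of "R * H"] uminus_l_inv_mat[OF AiG] AiG by simp
  have "S * P = four_block_mat (inv_mat A * A + R * 0\<^sub>m m n) (inv_mat A * G + R * H)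
      (0\<^sub>m m n * A + inv_mat H * 0\<^sub>m m n) (0\<^sub>m m n * G + inv_mat H * H)"
    unfolding P_def S_def Q_def[symmetric] R_def[symmetric]
    by (rule mult_four_block_mat[OF Ai(1) R zero_carrier_mat Hi(1) A(1) G zero_carrier_mat H(1)])
  then show "S * P = 1\<^sub>m (n + m)" using RH A(1) H(1) G Ai Hi R by simp
qed

text \<open>The preconditioned matrix is the identity plus the correction \<open>S * ?D\<close>,
  where \<open>?D\<close> carries the single block \<open>\<Xi>\<close> missing in
  \<open>P\<close>.\<close>

lemma block_triangular_preconditioner:
  fixes A H G \<Xi> :: "'a :: field mat"
  assumes A: "A \<in> carrier_mat n n" "invertible_mat A" and H: "H \<in> carrier_mat m m" "invertible_mat H"
    and G: "G \<in> carrier_mat n m" and X: "\<Xi> \<in> carrier_mat m n"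
  defines "P \<equiv> four_block_mat A G (0\<^sub>m m n) H"
    and "E \<equiv> inv_mat A * G" and "F \<equiv> inv_mat H * \<Xi>"
  shows "invertible_mat P"
    and "inv_mat P * four_block_mat A G \<Xi> H
      = 1\<^sub>m (n + m) - four_block_mat (E * F) (0\<^sub>m n m) (- F) (0\<^sub>m m m)"
proof -
  note Ai = inv_mat_invertible[OF A] and Hi = inv_mat_invertible[OF H]
  define S where
    "S = four_block_mat (inv_mat A) (- (inv_mat A * G * inv_mat H)) (0\<^sub>m m n) (inv_mat H)"
  note PS = block_triangular_inverse[OF A H G, folded P_def S_def]
  have P: "P \<in> carrier_mat (n + m) (n + m)" and S: "S \<in> carrier_mat (n + m) (n + m)"
    unfolding P_def S_def using A H Ai Hi by auto
  show "invertible_mat P" unfolding invertible_mat_def inverts_mat_def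
    using PS P S by auto
  let ?Q = "inv_mat A * G * inv_mat H"
  let ?D = "four_block_mat (0\<^sub>m n n) (0\<^sub>m n m) \<Xi> (0\<^sub>m m m)"
  have Q: "?Q \<in> carrier_mat n m" and E: "E \<in> carrier_mat n m" and F: "F \<in> carrier_mat m n"
    unfolding E_def F_def using Ai Hi G X by auto
  have D: "?D \<in> carrier_mat (n + m) (n + m)" by simp
  have QX: "?Q * \<Xi> = E * F" unfolding F_def E_def
    using Ai Hi G X by (intro assoc_mult_mat[of _ n m _ m _ n]) auto
  have "four_block_mat A G \<Xi> H = P + ?D" unfolding P_def
    using A G H X by (subst add_four_block_mat[of _ n n _ m _ m]) auto
  moreover have "S * (P + ?D) = S * P + S * ?D" by (rule mult_add_distrib_mat[OF S P D])
  \<comment> \<open>Only the second block column of \<open>S\<close> meets \<open>\<Xi>\<close>; it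
    yields the blocks \<open>- (E * F)\<close> and \<open>F\<close>.\<close>
  moreover have "S * ?D = - four_block_mat (E * F) (0\<^sub>m n m) (- F) (0\<^sub>m m m)"
  proof -
    have "S * ?D = four_block_mat (- (E * F)) (0\<^sub>m n m) F (0\<^sub>m m m)"
      unfolding S_def using Ai Hi Q E F X
      by (subst mult_four_block_mat[of _ n n _ m _ m _ _ n _ m]) (auto simp: QX F_def)
    also have "\<dots> = - four_block_mat (E * F) (0\<^sub>m n m) (- F) (0\<^sub>m m m)"
      by (rule eq_matI) (use E F in auto)
    finally show ?thesis .
  qed
  moreover have "1\<^sub>m (n + m) + - Y = 1\<^sub>m (n + m) - Y"
    if "Y \<in> carrier_mat (n + m) (n + m)" for Y :: "'a mat"
    using that by (intro eq_matI) auto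
  ultimately show "inv_mat P * four_block_mat A G \<Xi> H
      = 1\<^sub>m (n + m) - four_block_mat (E * F) (0\<^sub>m n m) (- F) (0\<^sub>m m m)"
    unfolding inv_mat_eqI[OF P S PS] using PS E F by simp
qed

section \<open>The discretized elastic Helmholtz system\<close>

text \<open>The zero multi-index is a cell because every \<open>N i\<close> is at least 1. This
  supplies \<open>m > 0\<close> for the spectrum and the spectral radius.\<close>

lemma mac_cells_nonempty:
  assumes "mac_grid d N h cs fs ls"
  shows "length cs > 0"
proof -
  have "replicate d 0 \<in> set cs"
    using assms unfolding mac_grid_def mac_cells_def by (auto simp: Suc_le_eq)
  then show ?thesis by (auto intro: length_pos_if_in_set)
qed

theorem theorem3p2:
  fixes d :: nat and N :: "nat \<Rightarrow> nat" and h :: "nat \<Rightarrow> real"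
    and cs :: "midx list" and fs :: "(nat \<times> midx) list" and ls :: "(nat \<times> nat \<times> midx) list"
    and grad vgrad Wf We :: "real mat"
    and \<rho> \<Lambda> \<mu> \<gamma> :: "real vec" and \<omega> :: real
    and n m :: nat
    and B C :: "real mat"
    and A A\<^sub>p \<Xi> H\<^sub>p K P T Z :: "complex mat"
  assumes dim: "d = 2 \<or> d = 3"
    and grid: "mac_grid d N h cs fs ls"
    and n: "n = length fs" and m: "m = length cs"
    and grad: "is_cell_gradient N h cs fs grad"
    and vgrad: "is_vector_gradient N h fs ls vgrad"
    and Wf: "is_face_average N cs fs Wf"
    and We: "is_edge_average N cs ls We"
    and \<omega>: "\<omega> > 0"
    and \<rho>: "\<rho> \<in> carrier_vec m" "\<forall>i<m. \<rho> $ i > 0"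
    and \<Lambda>: "\<Lambda> \<in> carrier_vec m" "\<forall>i<m. \<Lambda> $ i > 0"
    and \<mu>: "\<mu> \<in> carrier_vec m" "\<forall>i<m. \<mu> $ i > 0"
    and \<gamma>: "\<gamma> \<in> carrier_vec m" "\<forall>i<m. \<gamma> $ i \<ge> 0"
    and A: "A = displacement_block vgrad We Wf \<omega> \<rho> \<mu> \<gamma>"
    and B: "B = transpose_mat grad"
    and C: "C = compliance_block \<Lambda> \<mu>"
    and A\<^sub>p: "A\<^sub>p = pressure_operator B \<omega> \<rho> \<mu> \<gamma>"
    and \<Xi>: "\<Xi> = cmat B * A - A\<^sub>p * cmat B"
    and H\<^sub>p: "H\<^sub>p = cmat (B * transpose_mat B) + A\<^sub>p * cmat C"
    and inv_A: "invertible_mat A"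
    and inv_H\<^sub>p: "invertible_mat H\<^sub>p"
    and K: "K = four_block_mat A (cmat (transpose_mat B)) \<Xi> H\<^sub>p"
    and P: "P = four_block_mat A (cmat (transpose_mat B)) (0\<^sub>m m n) H\<^sub>p"
    and T: "T = 1\<^sub>m (n + m) - inv_mat P * K"
    and Z: "Z = \<Xi> * inv_mat A * cmat (transpose_mat B) * inv_mat H\<^sub>p"
  shows "invertible_mat P \<and>
     (eigenvalue (inv_mat P * K) 1 \<and>
      n \<le> Polynomial.order 1 (char_poly (inv_mat P * K)) \<and>
      n \<le> kernel_dim T) \<and>
     (spectrum T = spectrum Z \<union> {0} \<and>
      spectral_radius T = spectral_radius Z)"
proof -
  define G where "G = cmat (transpose_mat B)"
  have grad_c: "grad \<in> carrier_mat n m" using grad n m unfolding is_cell_gradient_def by simp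
  have Wf_c: "Wf \<in> carrier_mat n m" using Wf n m unfolding is_face_average_def by simp
  have vgrad_c: "vgrad \<in> carrier_mat (length ls) n"
    using vgrad n unfolding is_vector_gradient_def by simp
  have B_c: "B \<in> carrier_mat m n" using grad_c unfolding B by simp
  have G_c: "G \<in> carrier_mat n m" using B_c unfolding G_def by simp
  have A_c: "A \<in> carrier_mat n n"
    unfolding A displacement_block_def face_mass_def diag_of_def
    using Wf_c vgrad_c by (intro minus_carrier_mat smult_carrier_mat) (simp add: mat_diag_def)
  have Ap_c: "A\<^sub>p \<in> carrier_mat m m"
    unfolding A\<^sub>p pressure_operator_def diag_of_def complex_density_def
    using \<rho>(1) by (intro minus_carrier_mat smult_carrier_mat) (simp add: mat_diag_def)
  have \<Xi>_c: "\<Xi> \<in> carrier_mat m n" unfolding \<Xi> using B_c A_c Ap_c by auto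
  have H_c: "H\<^sub>p \<in> carrier_mat m m"
    unfolding H\<^sub>p C compliance_block_def diag_of_def using B_c Ap_c \<mu>(1) by auto
  have m0: "m > 0" using mac_cells_nonempty[OF grid] m by simp
  define E where "E = inv_mat A * G"
  define F where "F = inv_mat H\<^sub>p * \<Xi>"
  note Ai = inv_mat_invertible[OF A_c inv_A] and Hi = inv_mat_invertible[OF H_c inv_H\<^sub>p]
  have E: "E \<in> carrier_mat n m" and F: "F \<in> carrier_mat m n"
    unfolding E_def F_def using Ai Hi G_c \<Xi>_c by auto
  let ?T = "four_block_mat (E * F) (0\<^sub>m n m) (- F) (0\<^sub>m m m)"
  have T_c: "?T \<in> carrier_mat (n + m) (n + m)" using E F by auto
  note precond = block_triangular_preconditioner[OF A_c inv_A H_c inv_H\<^sub>p G_c \<Xi>_c,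
      folded E_def F_def, unfolded G_def, folded P K]
  have T_eq: "T = ?T" unfolding T precond(2) by (rule eq_matI) (use T_c in auto)
  have FE: "F * E \<in> carrier_mat m m" and XE: "\<Xi> * E \<in> carrier_mat m m" using E F \<Xi>_c by auto
  have Z_eq: "Z = \<Xi> * E * inv_mat H\<^sub>p"
    unfolding Z E_def G_def[symmetric] using assoc_mult_mat[OF \<Xi>_c Ai(1) G_c] by simp
  then have Z_c: "Z \<in> carrier_mat m m" using XE Hi by simp
  have "F * E = inv_mat H\<^sub>p * (\<Xi> * E)"
    unfolding F_def by (rule assoc_mult_mat[OF Hi(1) \<Xi>_c E])
  \<comment> \<open>Inserting \<open>inv_mat H\<^sub>p * H\<^sub>p\<close> on the right makes the
    factor \<open>Z\<close> appear.\<close>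
  also have "\<dots> = inv_mat H\<^sub>p * (\<Xi> * E * (inv_mat H\<^sub>p * H\<^sub>p))" using Hi(3) right_mult_one_mat[OF XE] by simp
  also have "\<dots> = inv_mat H\<^sub>p * Z * H\<^sub>p"
    unfolding Z_eq assoc_mult_mat[OF XE Hi(1) H_c, symmetric]
    using Hi XE H_c by (intro assoc_mult_mat[symmetric, of _ m m _ m _ m]) auto
  finally have "similar_mat (F * E) Z"
    using FE Z_c Hi H_c by (intro similar_matI[of _ _ "inv_mat H\<^sub>p" H\<^sub>p m]) auto
  then have "spectrum (F * E) = spectrum Z"
    unfolding spectrum_root_char_poly[OF FE] spectrum_root_char_poly[OF Z_c]
    by (simp add: char_poly_similar)
  then have spec: "spectrum T = spectrum Z \<union> {0}"
    unfolding T_eq using spectrum_error_iteration[OF E F m0] by simp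
  have PK: "inv_mat P * K \<in> carrier_mat (n + m) (n + m)" unfolding precond(2) by (rule minus_carrier_mat[OF T_c])
  \<comment> \<open>The eigenvalue is taken from the spectrum, since for \<open>n = 0\<close> the
    bound on the order would not give it.\<close>
  have "eigenvalue T 0" using spec unfolding spectrum_def by auto
  then have "eigenvalue (inv_mat P * K) 1"
    using eigenvalue_one_minus[OF PK, of 0] unfolding T by simp
  moreover have "n \<le> Polynomial.order 1 (char_poly (inv_mat P * K))"
    unfolding precond(2) by (rule order_one_minus_error_iteration[OF E F])
  moreover have "n \<le> kernel_dim T" unfolding T_eq by (rule kernel_dim_error_iteration[OF E F])
  ultimately show ?thesis
    using precond(1) spec spectral_radius_insert_zero[OF Z_c m0 spec] by blast
qed

end
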